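(* Let $k \geq 1$ and $n$ be integers with $n \geq (3k+1)(k-2)$. Then \[\frac{1}{2}kn \geq \mathcal{G}(K_n, K_{1,k+1}) \geq \frac{1}{2}\bigl(kn - 2(k-1)\bigr).\]
   Context: $K_{1,k+1}$ is the star with $k+1$ leaves. For a family $\mathcal{F}$ of graphs, a graph is $\mathcal{F}$-free if it contains no member of $\mathcal{F}$ as a subgraph; a subgraph $G \subseteq H$ is $\mathcal{F}$-saturated in $H$ if it is a maximal $\mathcal{F}$-free subgraph of $H$. The $\mathcal{F}$-saturation game $\mathcal{G}(H;\mathcal{F})$: two players, Prolonger and Shortener, alternately add to a graph on $V(H)$, starting from the empty graph, one edge of $H$ not yet present such that the graph remains $\mathcal{F}$-free; the game ends when the graph is $\mathcal{F}$-saturated in $H$. Prolonger aims to maximise and Shortener to minimise the number of edges added; $\mathcal{G}(H;\mathcal{F})$ also denotes this number under optimal play by both players (the game saturation number). The bounds hold regardless of which player moves first. $\mathcal{G}(K_n, K_{1,k+1})$ means $H = K_n$, $\mathcal{F} = \{K_{1,k+1}\}$.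
   Formalization: The lower bound is not claimed for k = 1 with n odd, where it is false: every saturated graph is then a matching with (n-1)/2 edges, less than the claimed n/2. *)

theory Defs
  imports Complex_Main
begin

text \<open>A simple graph is a pair of a vertex set and a set of two-element subsets of it.\<close>

type_synonym 'a sgraph = "'a set \<times> 'a set set"

abbreviation verts :: "'a sgraph \<Rightarrow> 'a set" where "verts G \<equiv> fst G"
abbreviation edges :: "'a sgraph \<Rightarrow> 'a set set" where "edges G \<equiv> snd G"

definition simple_graph :: "'a sgraph \<Rightarrow> bool" where
  "simple_graph G \<longleftrightarrow> (\<forall>e\<in>edges G. e \<subseteq> verts G \<and> card e = 2)"

definition subgraph :: "'a sgraph \<Rightarrow> 'a sgraph \<Rightarrow> bool" where
  "subgraph G H \<longleftrightarrow> simple_graph G \<and> verts G \<subseteq> verts H \<and> edges G \<subseteq> edges H"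

text \<open>Containment as a not necessarily induced subgraph, up to isomorphism.\<close>

definition contains_graph :: "'a sgraph \<Rightarrow> 'b sgraph \<Rightarrow> bool" where
  "contains_graph G F \<longleftrightarrow>
     (\<exists>f. inj_on f (verts F) \<and> f ` verts F \<subseteq> verts G \<and> (\<forall>e\<in>edges F. f ` e \<in> edges G))"

definition free_of :: "'b sgraph set \<Rightarrow> 'a sgraph \<Rightarrow> bool" where
  "free_of \<F> G \<longleftrightarrow> (\<forall>F\<in>\<F>. \<not> contains_graph G F)"

definition saturated_in :: "'a sgraph \<Rightarrow> 'b sgraph set \<Rightarrow> 'a sgraph \<Rightarrow> bool" where
  "saturated_in H \<F> G \<longleftrightarrow>
     subgraph G H \<and> free_of \<F> G \<and>
     (\<forall>G'. subgraph G' H \<and> free_of \<F> G' \<and> subgraph G G' \<longrightarrow> G' = G)"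

text \<open>A position of the game is the edge set of a spanning subgraph of the host graph.\<close>

definition legal_moves :: "'a sgraph \<Rightarrow> 'b sgraph set \<Rightarrow> 'a set set \<Rightarrow> 'a set set" where
  "legal_moves H \<F> E = {e \<in> edges H - E. free_of \<F> (verts H, insert e E)}"

datatype player = Prolonger | Shortener

fun opponent :: "player \<Rightarrow> player" where
  "opponent Prolonger = Shortener"
| "opponent Shortener = Prolonger"

fun optimum :: "player \<Rightarrow> nat set \<Rightarrow> nat" where
  "optimum Prolonger A = Max A"
| "optimum Shortener A = Min A"

text \<open>
  The number of edges still to be added under optimal play when \<open>p\<close> is to move in position \<open>E\<close>.
  Finiteness of the host graph is tested only to make the recursion terminate. If the position
  is \<open>\<F>\<close>-free but not saturated, then there is a legal move, so that \<^const>\<open>Max\<close> and \<^const>\<open>Min\<close>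
  are applied to nonempty finite sets.
\<close>

function game_value :: "'a sgraph \<Rightarrow> 'b sgraph set \<Rightarrow> player \<Rightarrow> 'a set set \<Rightarrow> nat" where
  "game_value H \<F> p E =
     (if finite (edges H) \<and> \<not> saturated_in H \<F> (verts H, E)
      then optimum p ((\<lambda>e. Suc (game_value H \<F> (opponent p) (insert e E))) ` legal_moves H \<F> E)
      else 0)"
  by pat_completeness auto
termination
proof (relation "measure (\<lambda>(H, \<F>, p, E). card (edges H - E))", goal_cases)
  case (2 H \<F> p E e)
  then have "edges H - insert e E \<subset> edges H - E" "finite (edges H - E)"
    by (auto simp: legal_moves_def)
  then show ?case by (simp add: psubset_card_mono)
qed simp

declare game_value.simps [simp del]

definition game_saturation_number :: "player \<Rightarrow> 'a sgraph \<Rightarrow> 'b sgraph set \<Rightarrow> nat" where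
  "game_saturation_number first H \<F> = game_value H \<F> first {}"

definition complete_graph :: "nat \<Rightarrow> nat sgraph" where
  "complete_graph n = ({..<n}, {e. e \<subseteq> {..<n} \<and> card e = 2})"

definition star :: "nat \<Rightarrow> nat sgraph" where
  "star m = ({..m}, {{0, i} | i. i \<in> {1..m}})"

end

theory Submission
  imports Defs
begin

text \<open>
  Call a vertex open while its degree is below \<open>k\<close>. In a final position the open vertices form a
  clique, so if all degrees are at least \<open>k - 2\<close>, the total deficiency \<open>kn - 2|E|\<close> is at most
  \<open>2(k - 1)\<close> (using parity if \<open>k = 1\<close>). Prolonger forces this by always joining two nonadjacent vertices of the
  minimum degree \<open>t\<close> or, if these form a clique (of size at most \<open>t + 1\<close>), by joining one of them to
  any open vertex. With \<open>r = k - 1 - t\<close>, the deficiencies truncated at \<open>r\<close> do not notice moves that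
  raise a vertex from degree \<open>t\<close> to \<open>t + 1\<close>; so their sum is hardly affected by Prolonger, drops by
  at most 2 with each move of Shortener, and stays large enough for open vertices to be available
  until the minimum degree has reached \<open>k - 2\<close>.
\<close>

section \<open>Positions of bounded degree\<close>

definition deg :: "'a set set \<Rightarrow> 'a \<Rightarrow> nat" where
  "deg E v = card {e \<in> E. v \<in> e}"

definition position :: "nat \<Rightarrow> nat \<Rightarrow> nat set set \<Rightarrow> bool" where
  "position n k E \<longleftrightarrow> E \<subseteq> edges (complete_graph n) \<and> (\<forall>v<n. deg E v \<le> k)"

definition open_verts :: "nat \<Rightarrow> nat \<Rightarrow> nat set set \<Rightarrow> nat set" where
  "open_verts n k E = {v. v < n \<and> deg E v < k}"

lemma verts_complete_graph [simp]: "verts (complete_graph n) = {..<n}"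
  by (simp add: complete_graph_def)

lemma edges_complete_graph: "edges (complete_graph n) = {e. e \<subseteq> {..<n} \<and> card e = 2}"
  by (simp add: complete_graph_def)

lemma finite_edges_complete_graph [simp]: "finite (edges (complete_graph n))"
  by (rule finite_subset[of _ "Pow {..<n}"]) (auto simp: edges_complete_graph)

lemma doubleton_in_complete_graph:
  "{u, v} \<in> edges (complete_graph n) \<longleftrightarrow> u < n \<and> v < n \<and> u \<noteq> v"
  by (auto simp: edges_complete_graph card_2_iff doubleton_eq_iff)

lemma finite_open_verts [simp]: "finite (open_verts n k E)"
  by (simp add: open_verts_def)

lemma position_finite: "position n k E \<Longrightarrow> finite E"
  by (meson finite_edges_complete_graph finite_subset position_def)

lemma deg_mono: "finite E' \<Longrightarrow> E \<subseteq> E' \<Longrightarrow> deg E v \<le> deg E' v"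
  unfolding deg_def by (rule card_mono) auto

lemma deg_insert:
  assumes "finite E" "e \<notin> E"
  shows "deg (insert e E) v = deg E v + (if v \<in> e then 1 else 0)"
proof -
  have "{e' \<in> insert e E. v \<in> e'} = (if v \<in> e then insert e {e' \<in> E. v \<in> e'} else {e' \<in> E. v \<in> e'})"
    by auto
  then show ?thesis
    using assms by (simp add: deg_def)
qed

lemma deg_eq_card_neighbours:
  assumes "E \<subseteq> edges (complete_graph n)"
  shows "deg E v = card {w. {v, w} \<in> E}"
proof -
  have "bij_betw (\<lambda>w. {v, w}) {w. {v, w} \<in> E} {e \<in> E. v \<in> e}"
    unfolding bij_betw_def
  proof
    show "inj_on (\<lambda>w. {v, w}) {w. {v, w} \<in> E}"
      by (auto simp: inj_on_def doubleton_eq_iff)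
    show "(\<lambda>w. {v, w}) ` {w. {v, w} \<in> E} = {e \<in> E. v \<in> e}"
    proof (intro equalityI subsetI)
      fix e assume e: "e \<in> {e \<in> E. v \<in> e}"
      then have "card e = 2"
        using assms by (auto simp: edges_complete_graph)
      then obtain w where "e = {v, w}"
        using e by (auto simp: card_2_iff)
      with e show "e \<in> (\<lambda>w. {v, w}) ` {w. {v, w} \<in> E}"
        by auto
    qed auto
  qed
  then show ?thesis
    unfolding deg_def by (simp add: bij_betw_same_card)
qed

lemma finite_neighbours:
  assumes "E \<subseteq> edges (complete_graph n)"
  shows "finite {w. {v, w} \<in> E}"
  by (rule finite_subset[of _ "{..<n}"]) (use assms in \<open>auto simp: edges_complete_graph\<close>)

lemma sum_deg:
  assumes "E \<subseteq> edges (complete_graph n)"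
  shows "(\<Sum>v<n. deg E v) = 2 * card E"
proof -
  have fin: "finite E"
    using assms finite_edges_complete_graph finite_subset by blast
  have "(\<Sum>v<n. deg E v) = (\<Sum>v<n. \<Sum>e\<in>E. if v \<in> e then 1 else 0)"
    using fin by (simp add: deg_def sum.If_cases Int_def conj_commute)
  also have "\<dots> = (\<Sum>e\<in>E. \<Sum>v<n. if v \<in> e then 1 else 0)"
    by (rule sum.swap)
  also have "\<dots> = (\<Sum>e\<in>E. 2)"
  proof (rule sum.cong)
    fix e assume "e \<in> E"
    then have e: "e \<subseteq> {..<n}" "card e = 2"
      using assms by (auto simp: edges_complete_graph)
    then have "{..<n} \<inter> {v. v \<in> e} = e" by auto
    then show "(\<Sum>v<n. if v \<in> e then 1 else 0) = (2::nat)"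
      using e by (simp add: sum.If_cases)
  qed simp
  finally show ?thesis by simp
qed

text \<open>All of \<open>X\<close> except possibly \<open>x\<close> lies in the neighbourhood of
  \<open>x\<close>. This bounds cliques and, read contrapositively, yields a non-neighbour of
  \<open>x\<close> in a large set.\<close>

lemma card_le_deg_if_joined:
  assumes E: "E \<subseteq> edges (complete_graph n)"
    and joined: "\<And>y. y \<in> X \<Longrightarrow> y \<noteq> x \<Longrightarrow> {x, y} \<in> E"
  shows "card X \<le> Suc (deg E x)"
proof -
  have "card (X - {x}) \<le> card {w. {x, w} \<in> E}"
    by (rule card_mono[OF finite_neighbours[OF E]]) (use joined in auto)
  moreover have "card X \<le> Suc (card (X - {x}))"
    by (cases "x \<in> X") simp_all
  ultimately show ?thesis
    unfolding deg_eq_card_neighbours[OF E] by linarith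
qed

section \<open>Star-freeness as a degree condition\<close>

text \<open>An embedding sends the centre 0 to a vertex with \<open>m\<close> distinct neighbours;
  conversely any \<open>m\<close> neighbours of \<open>v\<close> serve as leaves, and they differ
  from \<open>v\<close> because edges have two elements.\<close>

lemma contains_star_iff:
  assumes E: "E \<subseteq> edges (complete_graph n)"
  shows "contains_graph ({..<n}, E) (star m) \<longleftrightarrow> (\<exists>v<n. m \<le> deg E v)"
proof
  assume "contains_graph ({..<n}, E) (star m)"
  then obtain f where f: "inj_on f {..m}" "f ` {..m} \<subseteq> {..<n}"
    and "\<forall>e\<in>{{0, i} | i. i \<in> {1..m}}. f ` e \<in> E"
    unfolding contains_graph_def star_def by (simp only: fst_conv snd_conv) blast
  then have fE: "f ` {0, i} \<in> E" if "i \<in> {1..m}" for i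
    using that by blast
  have "card (f ` {1..m}) \<le> card {w. {f 0, w} \<in> E}"
    by (rule card_mono[OF finite_neighbours[OF E]]) (use fE in auto)
  moreover have "card (f ` {1..m}) = m"
    using f by (subst card_image) (auto intro: inj_on_subset)
  moreover have "f 0 < n" using f by auto
  ultimately show "\<exists>v<n. m \<le> deg E v"
    using deg_eq_card_neighbours[OF E] by metis
next
  assume "\<exists>v<n. m \<le> deg E v"
  then obtain v where v: "v < n" "m \<le> card {w. {v, w} \<in> E}"
    using deg_eq_card_neighbours[OF E] by metis
  then obtain S where S: "S \<subseteq> {w. {v, w} \<in> E}" "card S = m" "finite S"
    by (meson obtain_subset_with_card_n)
  then obtain g where g: "bij_betw g {1..m} S"
    using ex_bij_betw_nat_finite_1 by blast
  have nb: "w < n \<and> w \<noteq> v" if "w \<in> S" for w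
    using that S E doubleton_in_complete_graph[of v w n] by auto
  define f where "f i = (if i = 0 then v else g i)" for i
  have gS: "g i \<in> S" if "i \<in> {1..m}" for i
    using g that by (auto simp: bij_betw_def)
  have "inj_on f {..m}"
  proof (rule inj_onI)
    fix i j assume ij: "i \<in> {..m}" "j \<in> {..m}" "f i = f j"
    show "i = j"
    proof (cases "i = 0 \<or> j = 0")
      case True
      then show ?thesis
        using ij gS[of i] gS[of j] nb[of "g i"] nb[of "g j"]
        by (auto simp: f_def split: if_splits)
    next
      case False
      then have "g i = g j" "i \<in> {1..m}" "j \<in> {1..m}"
        using ij by (simp_all add: f_def)
      then show ?thesis
        using g by (meson bij_betw_imp_inj_on inj_onD)
    qed
  qed
  moreover have "f ` {..m} \<subseteq> {..<n}"
    using gS nb v by (auto simp: f_def)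
  moreover have "f ` {0, i} \<in> E" if "i \<in> {1..m}" for i
  proof -
    have "{v, g i} \<in> E"
      using gS[OF that] S by blast
    then show ?thesis
      using that by (simp add: f_def insert_commute)
  qed
  ultimately show "contains_graph ({..<n}, E) (star m)"
    unfolding contains_graph_def star_def fst_conv snd_conv by blast
qed

lemma free_of_star_iff:
  assumes "E \<subseteq> edges (complete_graph n)"
  shows "free_of {star (k + 1)} ({..<n}, E) \<longleftrightarrow> (\<forall>v<n. deg E v \<le> k)"
  using contains_star_iff[OF assms, of "k + 1"] by (auto simp: free_of_def not_less_eq_eq)

section \<open>Moves and saturation\<close>

definition moves :: "nat \<Rightarrow> nat \<Rightarrow> nat set set \<Rightarrow> nat set set" where
  "moves n k E = legal_moves (complete_graph n) {star (k + 1)} E"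

lemma moves_eq: "E \<subseteq> edges (complete_graph n) \<Longrightarrow>
  moves n k E = {e \<in> edges (complete_graph n) - E. position n k (insert e E)}"
  using free_of_star_iff[of "insert e E" n k for e]
  by (auto simp: moves_def legal_moves_def position_def)

lemma position_moves:
  assumes "position n k E" "e \<in> moves n k E"
  shows "position n k (insert e E)" "e \<notin> E" "finite E" "e \<in> edges (complete_graph n)"
  using assms position_finite[OF assms(1)] by (auto simp: moves_eq position_def)

lemma join_open_verts:
  assumes E: "position n k E" and "u \<in> open_verts n k E" "v \<in> open_verts n k E"
    and "u \<noteq> v" "{u, v} \<notin> E"
  shows "{u, v} \<in> moves n k E"
proof -
  have "{u, v} \<in> edges (complete_graph n)"
    using assms by (auto simp: open_verts_def doubleton_in_complete_graph)
  then show ?thesis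
    using assms position_finite[OF E]
    by (auto simp: moves_eq position_def deg_insert open_verts_def)
qed

text \<open>Saturation speaks of arbitrary larger subgraphs, but degrees grow with the edge set: if
  a proper extension respects the bound \<open>k\<close>, then so does adding just one of its new
  edges.\<close>

lemma saturated_iff_no_moves:
  assumes E: "position n k E"
  shows "saturated_in (complete_graph n) {star (k + 1)} ({..<n}, E) \<longleftrightarrow> moves n k E = {}"
proof -
  have sub: "subgraph ({..<n}, E') (complete_graph n) \<longleftrightarrow> E' \<subseteq> edges (complete_graph n)" for E'
    by (auto simp: subgraph_def simple_graph_def edges_complete_graph)
  have EE: "E \<subseteq> edges (complete_graph n)" and free: "free_of {star (k + 1)} ({..<n}, E)"
    using E free_of_star_iff by (auto simp: position_def)
  show ?thesis
  proof
    assume sat: "saturated_in (complete_graph n) {star (k + 1)} ({..<n}, E)"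
    show "moves n k E = {}"
    proof (rule ccontr)
      assume "moves n k E \<noteq> {}"
      then obtain e where e: "e \<in> moves n k E" by auto
      let ?G = "({..<n}, insert e E)"
      have "subgraph ?G (complete_graph n)" "free_of {star (k + 1)} ?G" "subgraph ({..<n}, E) ?G"
        using e EE sub[of "insert e E"] sub[of E]
        by (auto simp: moves_def legal_moves_def subgraph_def)
      then have "insert e E = E"
        using sat unfolding saturated_in_def by blast
      then show False
        using e by (auto simp: moves_def legal_moves_def)
    qed
  next
    assume none: "moves n k E = {}"
    have "G' = ({..<n}, E)"
      if G': "subgraph G' (complete_graph n)" "free_of {star (k + 1)} G'" "subgraph ({..<n}, E) G'"
      for G'
    proof -
      obtain V E' where [simp]: "G' = (V, E')" by (cases G')
      have V: "V = {..<n}" and E': "E' \<subseteq> edges (complete_graph n)" "E \<subseteq> E'"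
        using G' by (auto simp: subgraph_def)
      have "E' \<subseteq> E"
      proof
        fix e assume e: "e \<in> E'"
        show "e \<in> E"
        proof (rule ccontr)
          assume "e \<notin> E"
          have fin: "finite E'"
            using E' finite_subset finite_edges_complete_graph by blast
          have "deg (insert e E) v \<le> k" if "v < n" for v
            using deg_mono[OF fin, of "insert e E" v] E' e free_of_star_iff[OF E'(1), of k] G'(2) V that
            by (metis \<open>G' = (V, E')\<close> insert_subset le_trans)
          then have "e \<in> moves n k E"
            using EE E' e \<open>e \<notin> E\<close> by (auto simp: moves_eq position_def)
          with none show False by simp
        qed
      qed
      with E' V show ?thesis by auto
    qed
    then show "saturated_in (complete_graph n) {star (k + 1)} ({..<n}, E)"
      using EE free sub unfolding saturated_in_def by blast
  qed
qed

section \<open>Values of the game\<close>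

definition star_value :: "nat \<Rightarrow> nat \<Rightarrow> player \<Rightarrow> nat set set \<Rightarrow> nat" where
  "star_value n k p E = game_value (complete_graph n) {star (k + 1)} p E"

lemma star_value_eq:
  assumes "position n k E"
  shows "star_value n k p E = (if moves n k E = {} then 0 else
    optimum p ((\<lambda>e. Suc (star_value n k (opponent p) (insert e E))) ` moves n k E))"
proof (cases "moves n k E = {}")
  case True
  with saturated_iff_no_moves[OF assms] show ?thesis
    unfolding star_value_def
    by (subst game_value.simps) (simp only: verts_complete_graph simp_thms if_True if_False)
next
  case False
  with saturated_iff_no_moves[OF assms] show ?thesis
    unfolding star_value_def
    by (subst game_value.simps)
      (simp only: moves_def verts_complete_graph finite_edges_complete_graph simp_thms if_True if_False)
qed

lemma finite_moves [simp]: "finite (moves n k E)"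
  by (rule finite_subset[OF _ finite_edges_complete_graph[of n]]) (auto simp: moves_def legal_moves_def)

lemma star_value_attained:
  assumes "position n k E" "moves n k E \<noteq> {}"
  shows "\<exists>e\<in>moves n k E. star_value n k p E = Suc (star_value n k (opponent p) (insert e E))"
proof -
  let ?A = "(\<lambda>e. Suc (star_value n k (opponent p) (insert e E))) ` moves n k E"
  have "optimum p ?A \<in> ?A"
    using assms by (cases p) (auto simp del: image_iff intro!: Max_in Min_in)
  then show ?thesis
    using star_value_eq[OF assms(1), of p] assms(2) by auto
qed

lemma star_value_Prolonger_ge:
  assumes "position n k E" "e \<in> moves n k E"
  shows "Suc (star_value n k Shortener (insert e E)) \<le> star_value n k Prolonger E"
  using assms star_value_eq[OF assms(1), of Prolonger] by (auto intro!: Max_ge)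

text \<open>The measure for the inductions over the course of the game.\<close>

lemma card_unused_edges_less:
  assumes "e \<in> moves n k E"
  shows "card (edges (complete_graph n) - insert e E) < card (edges (complete_graph n) - E)"
  using assms by (intro psubset_card_mono) (auto simp: moves_def legal_moves_def)

text \<open>The value is attained along some play, so \<open>card E\<close> plus the value is the
  size of a final position, whose degree sum is at most \<open>k * n\<close>.\<close>

lemma star_value_upper:
  "position n k E \<Longrightarrow> 2 * (card E + star_value n k p E) \<le> k * n"
proof (induction "card (edges (complete_graph n) - E)" arbitrary: p E rule: less_induct)
  case less
  show ?case
  proof (cases "moves n k E = {}")
    case True
    have "(\<Sum>v<n. deg E v) \<le> (\<Sum>v<n. k)"
      by (rule sum_mono) (use less.prems in \<open>auto simp: position_def\<close>)
    with True show ?thesis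
      using less.prems sum_deg[of E n] star_value_eq[OF less.prems, of p]
      by (simp add: position_def mult.commute)
  next
    case False
    then obtain e where e: "e \<in> moves n k E"
      and v: "star_value n k p E = Suc (star_value n k (opponent p) (insert e E))"
      using star_value_attained[OF less.prems] by blast
    show ?thesis
      using less.hyps[OF card_unused_edges_less[OF e] position_moves(1)[OF less.prems e],
          of "opponent p"] v position_moves(2,3)[OF less.prems e]
      by simp
  qed
qed

section \<open>Final positions with large minimum degree\<close>

text \<open>Two nonadjacent open vertices would give a move, so the open vertices form a clique. If
  \<open>d\<close> is their least degree, there are at most \<open>d + 1\<close> of them, each of
  deficiency at most \<open>k - d\<close>. For \<open>d = k - 1\<close> or \<open>d = k - 2\<close>
  the product is \<open>k\<close> or \<open>2 * (k - 1)\<close>.\<close>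

lemma final_position_bound:
  assumes E: "position n k E" and none: "moves n k E = {}" and k: "k \<ge> 1"
    and low: "\<And>v. v < n \<Longrightarrow> k - 2 \<le> deg E v" and par: "k = 1 \<Longrightarrow> even n"
  shows "k * n \<le> 2 * card E + 2 * (k - 1)"
proof -
  let ?U = "open_verts n k E"
  define D where "D = (\<Sum>v<n. k - deg E v)"
  have "(\<Sum>v<n. k) = (\<Sum>v<n. deg E v) + D"
    unfolding D_def sum.distrib[symmetric] by (rule sum.cong) (use E in \<open>auto simp: position_def\<close>)
  then have kn: "k * n = 2 * card E + D"
    using sum_deg[of E n] E by (simp add: position_def mult.commute)
  have D_open: "D = (\<Sum>v\<in>?U. k - deg E v)"
    unfolding D_def by (rule sum.mono_neutral_right) (auto simp: open_verts_def)
  show ?thesis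
  proof (cases "?U = {}")
    case True
    then show ?thesis using kn D_open by simp
  next
    case False
    then obtain u where u: "u \<in> ?U" and u_min: "\<And>v. v \<in> ?U \<Longrightarrow> deg E u \<le> deg E v"
      using ex_has_least_nat[of "\<lambda>v. v \<in> ?U" _ "deg E"] by blast
    have "card ?U \<le> Suc (deg E u)"
      using E join_open_verts[OF E u] none
      by (intro card_le_deg_if_joined[of E n]) (auto simp: position_def)
    moreover have "D \<le> card ?U * (k - deg E u)"
      unfolding D_open using sum_bounded_above[of ?U "\<lambda>v. k - deg E v" "k - deg E u"] u_min
      by (simp add: diff_le_mono2)
    ultimately have "D \<le> Suc (deg E u) * (k - deg E u)"
      by (meson le_trans mult_le_mono1)
    \<comment> \<open>For \<open>k = 1\<close> truncated subtraction makes both candidates 0;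
      \<open>k \<ge> 2\<close> keeps the second one genuine.\<close>
    moreover have "deg E u = k - 1 \<or> (deg E u = k - 2 \<and> k \<ge> 2)"
      using u low[of u] by (auto simp: open_verts_def)
    ultimately have D: "D \<le> k \<or> (k \<ge> 2 \<and> D \<le> (k - 1) * 2)"
      using k by (auto simp: Suc_diff_Suc numeral_2_eq_2)
    show ?thesis
    proof (cases "k = 1")
      case True
      \<comment> \<open>Here \<open>D\<close> is at most 1 while the claim demands 0, so parity has
        to decide.\<close>
      then have "even D" using kn par by (metis even_add even_mult_iff even_numeral)
      then have "D = 0" using True D by (auto elim!: evenE)
      then show ?thesis using kn by simp
    next
      case False
      then show ?thesis using D kn k by auto
    qed
  qed
qed

section \<open>The strategy of Prolonger\<close>

definition potential :: "nat \<Rightarrow> nat \<Rightarrow> nat \<Rightarrow> nat set set \<Rightarrow> nat" where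
  "potential n k r E = (\<Sum>v<n. min (k - deg E v) r)"

definition level :: "nat \<Rightarrow> nat \<Rightarrow> nat set set \<Rightarrow> nat set" where
  "level n t E = {v. v < n \<and> deg E v = t}"

text \<open>
  Here \<open>t\<close> is the minimum degree. Joining two vertices of \<open>level n t E\<close> costs Prolonger no potential,
  and the answer costs 2; this is covered by the first summand. The second summand pays for the
  at most \<open>k - 2\<close> moves that use only one vertex of the level, the slack \<open>s\<close> for a move of Shortener.
  The last summand is chosen such that it guarantees the inequality for \<open>t + 1\<close> once the level is
  empty.
\<close>

definition stage :: "nat \<Rightarrow> nat \<Rightarrow> nat \<Rightarrow> nat \<Rightarrow> nat \<Rightarrow> nat set set \<Rightarrow> bool" where
  "stage n k s t r E \<longleftrightarrow> t + r + 1 = k \<and> r \<ge> 2 \<and> (\<forall>v<n. t \<le> deg E v) \<and> level n t E \<noteq> {} \<and>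
     card (level n t E) + 2 * min (card (level n t E)) (k - 2) + s + (k - 1) * r * (3 * r - 5)
       \<le> potential n k r E"

text \<open>The invariant of the strategy: the target minimum degree is reached, or a stage is in
  progress. It is maintained with \<open>s = 0\<close> when Prolonger is to move and
  \<open>s = 2\<close> when Shortener is, 2 being the most that one move can cost.\<close>

definition promising :: "nat \<Rightarrow> nat \<Rightarrow> nat \<Rightarrow> nat set set \<Rightarrow> bool" where
  "promising n k s E \<longleftrightarrow> (\<forall>v<n. k - 2 \<le> deg E v) \<or> (\<exists>t r. stage n k s t r E)"

lemma finite_level [simp]: "finite (level n t E)"
  by (simp add: level_def)

lemma promising_antimono:
  assumes "promising n k s E" "s' \<le> s"
  shows "promising n k s' E"
proof -
  have "stage n k s' t r E" if "stage n k s t r E" for t r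
    using that assms(2) by (simp add: stage_def)
  then show ?thesis
    using assms(1) unfolding promising_def by blast
qed

section \<open>The potential and the passage between stages\<close>

lemma potential_le: "potential n k r E \<le> r * card (open_verts n k E)"
proof -
  have "potential n k r E = (\<Sum>v\<in>open_verts n k E. min (k - deg E v) r)"
    unfolding potential_def by (rule sum.mono_neutral_right) (auto simp: open_verts_def)
  also have "\<dots> \<le> r * card (open_verts n k E)"
    using sum_bounded_above[of "open_verts n k E" "\<lambda>v. min (k - deg E v) r" r]
    by (simp add: mult.commute)
  finally show ?thesis .
qed

text \<open>Holds vertex by vertex, with equality where the deficiency exceeds \<open>r\<close>. It
  transfers the lower bound on the potential to the next, smaller truncation.\<close>

lemma potential_decrease_r: "r * potential n k (Suc r) E \<le> Suc r * potential n k r E"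
proof -
  have "r * min d (Suc r) \<le> Suc r * min d r" for d
    by (cases "d \<le> r") (auto simp: min_def le_Suc_eq)
  then show ?thesis
    unfolding potential_def sum_distrib_left by (intro sum_mono)
qed

lemma card_level_le_potential:
  assumes "t + r + 1 = k"
  shows "r * card (level n t E) \<le> potential n k r E"
proof -
  have "r * card (level n t E) = (\<Sum>v\<in>level n t E. min (k - deg E v) r)"
    using assms by (auto simp: level_def mult.commute)
  also have "\<dots> \<le> potential n k r E"
    unfolding potential_def by (rule sum_mono2) (auto simp: level_def)
  finally show ?thesis .
qed

text \<open>A vertex going from degree \<open>t\<close> to \<open>t + 1\<close> has deficiency
  \<open>r + 1\<close> before and \<open>r\<close> after, both counted as \<open>r\<close>. Every
  other endpoint loses at most 1.\<close>

lemma potential_move: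
  assumes E: "position n k E" and e: "e \<in> moves n k E" and r: "t + r + 1 = k"
  shows "potential n k r E \<le> potential n k r (insert e E) + card (e - level n t E)"
proof -
  note m = position_moves[OF E e]
  have fin: "finite e" "e \<subseteq> {..<n}"
    using m(4) by (auto simp: edges_complete_graph intro: finite_subset)
  have "potential n k r E
      \<le> (\<Sum>v<n. min (k - deg (insert e E) v) r + (if v \<in> e - level n t E then 1 else 0))"
    unfolding potential_def
    by (rule sum_mono) (use m r in \<open>auto simp: deg_insert level_def\<close>)
  also have "\<dots> = potential n k r (insert e E) + card ({..<n} \<inter> (e - level n t E))"
    by (simp add: sum.distrib potential_def sum.If_cases Int_def)
  also have "{..<n} \<inter> (e - level n t E) = e - level n t E"
    using fin by auto
  finally show ?thesis .
qed

lemma level_move: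
  assumes E: "position n k E" and e: "e \<in> moves n k E" and t: "\<forall>v<n. t \<le> deg E v"
  shows "level n t (insert e E) = level n t E - e"
  using position_moves[OF E e] t by (auto simp: level_def deg_insert split: if_splits)

text \<open>If \<open>r = 2\<close>, the minimum degree is now at least \<open>k - 2\<close>.
  Otherwise write \<open>r = q + 3\<close>; the new truncation is \<open>q + 2\<close>. The factor
  \<open>r * (3 * r - 5)\<close> is the solution of f(r) (r - 2) / r = 2 + f(r - 1) with f(2) = 2,
  and this recurrence is what the computation uses.\<close>

lemma stage_advance:
  assumes k: "t + r + 1 = k" and r: "r \<ge> 2"
    and deg: "\<forall>v<n. t + 1 \<le> deg E v" and ne: "level n (t + 1) E \<noteq> {}"
    and pot: "(k - 1) * r * (3 * r - 5) \<le> potential n k r E"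
  shows "promising n k 2 E"
proof (cases "r = 2")
  case True
  then show ?thesis
    using k deg by (auto simp: promising_def)
next
  case False
  then obtain q where q: "r = Suc (Suc (Suc q))"
    using r by (metis One_nat_def Suc_1 add_2_eq_Suc le_Suc_ex not_less_eq_eq le_antisym
        not0_implies_Suc add.right_neutral)
  define P where "P = potential n k (q + 2) E"
  define a where "a = card (level n (t + 1) E)"
  have "(q + 2) * potential n k r E \<le> r * P"
    using potential_decrease_r[of "q + 2" n k E] q by (simp add: P_def)
  then have "(q + 2) * ((k - 1) * r * (3 * r - 5)) \<le> r * P"
    using pot by (meson le_trans mult_le_mono2)
  then have "r * ((q + 2) * (k - 1) * (3 * r - 5)) \<le> r * P"
    by (simp only: mult_ac)
  then have "(q + 2) * (k - 1) * (3 * r - 5) \<le> P"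
    by (rule mult_left_le_imp_le) (use r in simp)
  moreover have "3 * r - 5 = 3 * q + 4"
    using q by simp
  ultimately have P: "(q + 2) * (k - 1) * (3 * q + 4) \<le> P"
    by simp
  have "(q + 2) * a \<le> P"
    unfolding P_def a_def by (rule card_level_le_potential) (use k q in auto)
  moreover have "(q + 2) * ((q + 1) * (k - 1) * (3 * q + 4)) \<le> (q + 1) * P"
    using mult_le_mono2[OF P, of "q + 1"] by (simp only: mult_ac)
  \<comment> \<open>Of \<open>q + 2\<close> copies of \<open>P\<close>, one pays for the new level
    of size \<open>a\<close>; the other \<open>q + 1\<close> are estimated by the lower bound on
    \<open>P\<close>.\<close>
  ultimately have "(q + 2) * (a + (q + 1) * (k - 1) * (3 * q + 4)) \<le> (q + 2) * P"
    by (simp add: algebra_simps)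
  then have "a + (q + 1) * (k - 1) * (3 * q + 4) \<le> P"
    by (rule mult_left_le_imp_le) simp
  \<comment> \<open>The recurrence: besides the last summand of the new stage,
    \<open>2 * (k - 1)\<close> is left over, enough for the single moves and a slack of 2.\<close>
  moreover have "(q + 1) * d * (3 * q + 4) = 2 * d + d * (q + 2) * (3 * q + 1)" for d
    by (simp add: algebra_simps)
  from this[of "k - 1"]
  have "(q + 1) * (k - 1) * (3 * q + 4) = 2 * (k - 1) + (k - 1) * (q + 2) * (3 * q + 1)" .
  moreover have "2 * min a (k - 2) + 2 \<le> 2 * (k - 1)"
    using k r by auto
  ultimately have "a + 2 * min a (k - 2) + 2 + (k - 1) * (q + 2) * (3 * q + 1) \<le> P"
    by linarith
  then have "stage n k 2 (t + 1) (q + 2) E"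
    unfolding stage_def using k q deg ne by (simp add: P_def a_def)
  then show ?thesis
    by (auto simp: promising_def)
qed

text \<open>Common to both players: the potential lost is charged to the endpoints outside the
  level. Either the stage goes on, or the level is exhausted and \<open>stage_advance\<close>
  applies, which provides slack 2; hence the bound on \<open>s'\<close>.\<close>

lemma stage_move:
  assumes E: "position n k E" and e: "e \<in> moves n k E" and st: "stage n k s t r E"
    and a: "a = card (level n t E - e)"
    and pot: "a + 2 * min a (k - 2) + s' + (k - 1) * r * (3 * r - 5) + card (e - level n t E)
      \<le> potential n k r E"
    and s': "s' \<le> 2"
  shows "promising n k s' (insert e E)"
proof -
  note m = position_moves[OF E e]
  have k: "t + r + 1 = k" and r: "r \<ge> 2" and deg: "\<forall>v<n. t \<le> deg E v" and ne: "level n t E \<noteq> {}"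
    using st by (auto simp: stage_def)
  note lv = level_move[OF E e deg]
  have pot': "a + 2 * min a (k - 2) + s' + (k - 1) * r * (3 * r - 5) \<le> potential n k r (insert e E)"
    using pot potential_move[OF E e k] by linarith
  have deg': "\<forall>v<n. t \<le> deg (insert e E) v"
    using deg m by (auto simp: deg_insert)
  show ?thesis
  proof (cases "level n t (insert e E) = {}")
    case False
    then have "stage n k s' t r (insert e E)"
      unfolding stage_def using k r deg' pot' a lv by simp
    then show ?thesis by (auto simp: promising_def)
  next
    case True
    have "\<forall>v<n. t + 1 \<le> deg (insert e E) v"
      using deg' True by (force simp: level_def)
    moreover have "level n (t + 1) (insert e E) \<noteq> {}"
    proof -
      \<comment> \<open>A vertex that just left the level has degree exactly
        \<open>t + 1\<close>.\<close>
      obtain v where v: "v \<in> level n t E" using ne by auto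
      then have "v \<in> e" using True lv by auto
      with v have "v \<in> level n (t + 1) (insert e E)"
        using m by (simp add: level_def deg_insert)
      then show ?thesis by auto
    qed
    ultimately have "promising n k 2 (insert e E)"
      by (intro stage_advance[OF k r]) (use pot' in auto)
    then show ?thesis
      using promising_antimono s' by blast
  qed
qed

text \<open>The last summand of \<open>stage\<close> makes the potential at least
  \<open>r * (k - 1)\<close>, so at least \<open>k - 1\<close> vertices are open. As
  \<open>x\<close> has degree \<open>t \<le> k - 3\<close>, it cannot be adjacent to all the
  others.\<close>

lemma stage_single_move:
  assumes E: "position n k E" and st: "stage n k s t r E" and x: "x \<in> level n t E"
  shows "\<exists>y. {x, y} \<in> moves n k E"
proof -
  have k: "t + r + 1 = k" and r: "r \<ge> 2"
    using st by (auto simp: stage_def)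
  have x': "x \<in> open_verts n k E" "deg E x = t"
    using x k by (auto simp: level_def open_verts_def)
  have "1 \<le> 3 * r - 5"
    using r by linarith
  then have "r * (k - 1) \<le> (k - 1) * r * (3 * r - 5)"
    using mult_le_mono2[of 1 "3 * r - 5" "(k - 1) * r"] by (simp add: mult.commute)
  also have "\<dots> \<le> potential n k r E"
    using st by (simp add: stage_def)
  also have "\<dots> \<le> r * card (open_verts n k E)"
    by (rule potential_le)
  finally have "k - 1 \<le> card (open_verts n k E)"
    using r by simp
  then have "\<not> card (open_verts n k E) \<le> Suc (deg E x)"
    using x' k r by simp
  then obtain y where y: "y \<in> open_verts n k E" "y \<noteq> x" "{x, y} \<notin> E"
    using card_le_deg_if_joined[of E n "open_verts n k E" x] E by (auto simp: position_def)
  then have "{x, y} \<in> moves n k E"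
    using join_open_verts[OF E x'(1)] by auto
  then show ?thesis by blast
qed

section \<open>Preservation of the invariant by both players\<close>

text \<open>The two endpoints cost at most 2, which the slack absorbs, and the level does not grow.
  A minimum degree of \<open>k - 2\<close> persists under any move.\<close>

lemma Shortener_keeps_promising:
  assumes E: "position n k E" and e: "e \<in> moves n k E" and pr: "promising n k 2 E"
  shows "promising n k 0 (insert e E)"
proof (cases "\<forall>v<n. k - 2 \<le> deg E v")
  case True
  then show ?thesis
    using position_moves[OF E e] by (auto simp: promising_def deg_insert)
next
  case False
  then obtain t r where st: "stage n k 2 t r E"
    using pr by (auto simp: promising_def)
  have "card e = 2" "finite e"
    using position_moves(4)[OF E e] by (auto simp: edges_complete_graph intro: finite_subset)
  then have "card (e - level n t E) \<le> 2"
    by (metis Diff_subset card_mono)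
  moreover have "card (level n t E - e) \<le> card (level n t E)"
    by (simp add: card_mono)
  ultimately show ?thesis
    using st by (intro stage_move[OF E e st refl]) (auto simp: stage_def)
qed

lemma Prolonger_keeps_promising:
  assumes E: "position n k E" and pr: "promising n k 0 E" and some: "moves n k E \<noteq> {}"
  shows "\<exists>e\<in>moves n k E. promising n k 2 (insert e E)"
proof (cases "\<forall>v<n. k - 2 \<le> deg E v")
  case True
  obtain e where "e \<in> moves n k E" using some by auto
  then show ?thesis
    using True position_moves[OF E, of e] by (intro bexI[of _ e]) (auto simp: promising_def deg_insert)
next
  case False
  then obtain t r where st: "stage n k 0 t r E"
    using pr by (auto simp: promising_def)
  then have k: "t + r + 1 = k" and r: "r \<ge> 2" and ne: "level n t E \<noteq> {}"
    and pot: "card (level n t E) + 2 * min (card (level n t E)) (k - 2) + (k - 1) * r * (3 * r - 5)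
       \<le> potential n k r E"
    by (auto simp: stage_def)
  let ?L = "level n t E"
  have L_open: "?L \<subseteq> open_verts n k E"
    using k by (auto simp: level_def open_verts_def)
  show ?thesis
  proof (cases "\<exists>x\<in>?L. \<exists>y\<in>?L. x \<noteq> y \<and> {x, y} \<notin> E")
    case True
    then obtain x y where xy: "x \<in> ?L" "y \<in> ?L" "x \<noteq> y" "{x, y} \<notin> E" by auto
    then have e: "{x, y} \<in> moves n k E"
      using join_open_verts[OF E] L_open by auto
    let ?c = "card ?L" and ?a = "card (?L - {x, y})"
    have "card {x, y} \<le> ?c"
      by (rule card_mono) (use xy in auto)
    moreover have "?a = ?c - card {x, y}"
      using xy by (subst card_Diff_subset) auto
    ultimately have "?a + 2 = ?c"
      using xy by simp
    \<comment> \<open>The level shrinks by 2 at no cost in potential, which restores the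
      slack.\<close>
    then have "?a + 2 * min ?a (k - 2) + 2 \<le> ?c + 2 * min ?c (k - 2)"
      by linarith
    moreover have "card ({x, y} - ?L) = 0" using xy by simp
    ultimately have "?a + 2 * min ?a (k - 2) + 2 + (k - 1) * r * (3 * r - 5) + card ({x, y} - ?L)
        \<le> potential n k r E"
      using pot by linarith
    then have "promising n k 2 (insert {x, y} E)"
      by (intro stage_move[OF E e st refl]) simp_all
    with e show ?thesis by blast
  next
    case False
    obtain x where x: "x \<in> ?L" using ne by auto
    then obtain y where e: "{x, y} \<in> moves n k E"
      using stage_single_move[OF E st] by auto
    have "card ?L \<le> Suc (deg E x)"
      using False x E by (intro card_le_deg_if_joined[of E n]) (auto simp: position_def)
    \<comment> \<open>The level is a clique of size at most \<open>t + 1 = k - r\<close>. Below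
      \<open>k - 2\<close> the minimum in \<open>stage\<close> is the level size itself, so removing
      \<open>x\<close> frees 3 units: 2 for the slack and 1 for \<open>y\<close>.\<close>
    then have L: "card ?L \<le> k - 2"
      using x k r by (simp add: level_def)
    let ?c = "card ?L" and ?a = "card (?L - {x, y})"
    have "?a \<le> card (?L - {x})"
      by (rule card_mono) auto
    also have "\<dots> < ?c"
      by (rule card_Diff1_less[OF finite_level x])
    finally have "?a + 2 * min ?a (k - 2) + 3 \<le> ?c + 2 * min ?c (k - 2)"
      using L by linarith
    moreover have "card ({x, y} - ?L) \<le> card {y}"
      by (rule card_mono) (use x in auto)
    ultimately have "?a + 2 * min ?a (k - 2) + 2 + (k - 1) * r * (3 * r - 5) + card ({x, y} - ?L)
        \<le> potential n k r E"
      using pot by simp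
    then have "promising n k 2 (insert {x, y} E)"
      by (intro stage_move[OF E e st refl]) simp_all
    with e show ?thesis by blast
  qed
qed

text \<open>During a stage some vertex of the level can still be joined, so in a final position the
  first alternative of \<open>promising\<close> holds.\<close>

lemma promising_final_bound:
  assumes E: "position n k E" and none: "moves n k E = {}" and k: "k \<ge> 1"
    and pr: "promising n k s E" and par: "k = 1 \<Longrightarrow> even n"
  shows "k * n \<le> 2 * card E + 2 * (k - 1)"
proof -
  have "\<not> stage n k s t r E" for t r
  proof
    assume st: "stage n k s t r E"
    then obtain x where "x \<in> level n t E"
      by (auto simp: stage_def)
    then show False
      using stage_single_move[OF E st] none by auto
  qed
  then show ?thesis
    using pr final_position_bound[OF E none k _ par] by (auto simp: promising_def)
qed

fun slack :: "player \<Rightarrow> nat" where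
  "slack Prolonger = 0"
| "slack Shortener = 2"

text \<open>Induction along a play in which Prolonger keeps the invariant and Shortener answers
  optimally. Prolonger's move need not be optimal, since his value is a maximum.\<close>

lemma star_value_lower:
  assumes k: "k \<ge> 1" and par: "k = 1 \<Longrightarrow> even n"
  shows "position n k E \<Longrightarrow> promising n k (slack p) E
    \<Longrightarrow> k * n \<le> 2 * (card E + star_value n k p E) + 2 * (k - 1)"
proof (induction "card (edges (complete_graph n) - E)" arbitrary: p E rule: less_induct)
  case less
  show ?case
  proof (cases "moves n k E = {}")
    case True
    then have "star_value n k p E = 0"
      by (subst star_value_eq[OF less.prems(1)]) (rule if_P)
    moreover have "k * n \<le> 2 * card E + 2 * (k - 1)"
      by (rule promising_final_bound[OF less.prems(1) True k less.prems(2)]) (rule par)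
    ultimately show ?thesis
      by (simp only: add_0_right)
  next
    case False
    have "\<exists>e\<in>moves n k E. promising n k (slack (opponent p)) (insert e E) \<and>
      Suc (star_value n k (opponent p) (insert e E)) \<le> star_value n k p E"
    proof (cases p)
      case Prolonger
      then obtain e where "e \<in> moves n k E" "promising n k 2 (insert e E)"
        using Prolonger_keeps_promising[OF less.prems(1) _ False] less.prems(2) by auto
      then show ?thesis
        using Prolonger star_value_Prolonger_ge[OF less.prems(1)] by (intro bexI[of _ e]) simp_all
    next
      case Shortener
      obtain e where e: "e \<in> moves n k E"
        and v: "star_value n k p E = Suc (star_value n k (opponent p) (insert e E))"
        using star_value_attained[OF less.prems(1) False] by blast
      then show ?thesis
        using Shortener Shortener_keeps_promising[OF less.prems(1) e] less.prems(2)
        by (intro bexI[of _ e]) simp_all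
    qed
    then obtain e where e: "e \<in> moves n k E" "promising n k (slack (opponent p)) (insert e E)"
      and v: "Suc (star_value n k (opponent p) (insert e E)) \<le> star_value n k p E"
      by blast
    show ?thesis
      using less.hyps[OF card_unused_edges_less[OF e(1)] position_moves(1)[OF less.prems(1) e(1)] e(2)]
        v position_moves(2,3)[OF less.prems(1) e(1)]
      by simp
  qed
qed

section \<open>The empty position and the theorem\<close>

lemma deg_empty [simp]: "deg {} v = 0"
  by (simp add: deg_def)

text \<open>For \<open>k \<ge> 3\<close> the game starts in the stage with \<open>t = 0\<close> and
  \<open>r = k - 1\<close>, where all vertices form the level and the potential is
  \<open>n * (k - 1)\<close>.\<close>

lemma promising_empty:
  assumes "int n \<ge> (3 * int k + 1) * (int k - 2)"
  shows "promising n k 2 {}"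
proof (cases "k \<le> 2")
  case True
  then show ?thesis by (auto simp: promising_def)
next
  case False
  then obtain q where q: "k = q + 3"
    by (metis add.commute le_Suc_ex not_less_eq_eq numeral_2_eq_2 numeral_3_eq_3)
  have "int ((3 * q + 10) * (q + 1)) \<le> int n"
    using assms q by (simp add: algebra_simps)
  then have n: "(3 * q + 10) * (q + 1) \<le> n"
    by linarith
  then have n_ge: "q + 1 \<le> n"
    by (simp add: algebra_simps)
  have "(q + 2) * (3 * q + 4) \<le> n"
    using n by (simp add: algebra_simps)
  then have "(q + 1) * ((q + 2) * (3 * q + 4)) \<le> (q + 1) * n"
    by (rule mult_le_mono2)
  \<comment> \<open>The identity of \<open>stage_advance\<close> again:
    \<open>(q + 1) * (3 * q + 4) = 2 + (q + 2) * (3 * q + 1)\<close>, now multiplied by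
    \<open>q + 2\<close>.\<close>
  then have "n + 2 * (q + 1) + 2 + (q + 2) * (q + 2) * (3 * q + 1) \<le> n * (q + 2)"
    by (simp add: algebra_simps)
  moreover have "level n 0 {} = {..<n}"
    by (auto simp: level_def)
  moreover have "potential n k (q + 2) {} = n * (q + 2)"
    using q by (simp add: potential_def)
  ultimately have "stage n k 2 0 (q + 2) {}"
    using q n_ge by (auto simp: stage_def lessThan_empty_iff)
  then show ?thesis
    by (auto simp: promising_def)
qed

theorem theorem5:
  fixes k n :: nat and first :: player
  assumes "k \<ge> 1"
    and "int n \<ge> (3 * int k + 1) * (int k - 2)"
  shows "1 / 2 * real k * real n \<ge> real (game_saturation_number first (complete_graph n) {star (k + 1)})
    \<and> ((k = 1 \<longrightarrow> even n) \<longrightarrow>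
       real (game_saturation_number first (complete_graph n) {star (k + 1)})
         \<ge> 1 / 2 * (real k * real n - 2 * (real k - 1)))"
proof -
  let ?g = "game_saturation_number first (complete_graph n) {star (k + 1)}"
  have pos: "position n k {}"
    by (simp add: position_def)
  have "2 * ?g \<le> k * n"
    using star_value_upper[OF pos, of first] by (simp add: game_saturation_number_def star_value_def)
  then have "real (2 * ?g) \<le> real (k * n)"
    by (rule of_nat_mono)
  then have upper: "real ?g \<le> 1 / 2 * real k * real n"
    by simp
  have lower: "1 / 2 * (real k * real n - 2 * (real k - 1)) \<le> real ?g" if par: "k = 1 \<longrightarrow> even n"
  proof -
    \<comment> \<open>The empty position has slack 2, enough whoever starts.\<close>
    have "promising n k (slack first) {}"
      using promising_empty[OF assms(2)] by (cases first) (auto intro: promising_antimono)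
    then have "k * n \<le> 2 * ?g + 2 * (k - 1)"
      using star_value_lower[OF assms(1) _ pos, of first] par
      by (simp add: game_saturation_number_def star_value_def)
    then have "real (k * n) \<le> real (2 * ?g + 2 * (k - 1))"
      by (rule of_nat_mono)
    then show ?thesis
      using assms(1) by (simp add: of_nat_diff)
  qed
  show ?thesis
    using upper lower by blast
qed

end
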